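(* Let $\mathbb F$ be a field, let $H=([n],E)$ be a hypergraph (multiple edges allowed, every edge of size at least $2$), and let $p(x_1,\ldots,x_n)=\prod_{e\in E}\big(\sum_{i\in e}a_{e,i}x_i\big)$ with all $a_{e,i}\in\mathbb F\setminus\{0\}$ be a hypergraph polynomial of $H$. Then $$AT(p)-1\le\delta(H)\le\max_{e\in E}|e|\cdot\mathrm{ed}(H)\le\max_{e\in E}|e|\cdot(AT(p)-1).$$
   Context: For a polynomial $p=\sum_\alpha c_\alpha x_1^{\alpha_1}\cdots x_n^{\alpha_n}$, let $S(p)=\{\alpha:\sum_i\alpha_i=\deg p,\ c_\alpha\neq0\}$; the Alon--Tarsi number is $AT(p)=\min_{\alpha\in S(p)}\max\{\alpha_1,\ldots,\alpha_n\}+1$. The degeneracy of $H$ is $\delta(H)=\max_{\emptyset\neq X\subseteq V}\min_{i\in X}d_{H[X]}(i)$, where $d_{H[X]}(i)=|\{e\in E:i\in e\subseteq X\}|$. The edge density is $\mathrm{ed}(H)=\max_{\emptyset\neq X\subseteq V}|E(X)|/|X|$, where $E(X)=\{e\in E:e\subseteq X\}$ (counted with multiplicity). *)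

theory Defs
  imports Complex_Main "HOL-Library.Poly_Mapping"
begin

text \<open>
  Polynomials are finitely supported maps from exponent vectors to coefficients, with the
  convolution product of \<^theory>\<open>HOL-Library.Poly_Mapping\<close>. Variables are indexed by all
  natural numbers; a polynomial in \<open>x\<^sub>1, \<dots>, x\<^sub>n\<close> is one whose exponent vectors are
  supported in \<open>{1..n}\<close>.
\<close>

type_synonym 'a mpoly = "(nat \<Rightarrow>\<^sub>0 nat) \<Rightarrow>\<^sub>0 'a"

definition mvar :: "nat \<Rightarrow> 'a::{zero,one} mpoly" where
  "mvar i = Poly_Mapping.single (Poly_Mapping.single i 1) 1"

definition mconst :: "'a::zero \<Rightarrow> 'a mpoly" where
  "mconst c = Poly_Mapping.single 0 c"

definition mon_degree :: "nat \<Rightarrow> (nat \<Rightarrow>\<^sub>0 nat) \<Rightarrow> nat" where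
  "mon_degree n \<alpha> = (\<Sum>i\<in>{1..n}. Poly_Mapping.lookup \<alpha> i)"

text \<open>The degree is only meaningful for nonzero polynomials in \<open>x\<^sub>1, \<dots>, x\<^sub>n\<close>.\<close>

definition total_degree :: "nat \<Rightarrow> 'a::zero mpoly \<Rightarrow> nat" where
  "total_degree n p = Max (mon_degree n ` Poly_Mapping.keys p)"

definition top_exponents :: "nat \<Rightarrow> 'a::zero mpoly \<Rightarrow> (nat \<Rightarrow>\<^sub>0 nat) set" where
  "top_exponents n p =
     {\<alpha>. mon_degree n \<alpha> = total_degree n p \<and> Poly_Mapping.lookup p \<alpha> \<noteq> 0}"

definition alon_tarsi :: "nat \<Rightarrow> 'a::zero mpoly \<Rightarrow> nat" where
  "alon_tarsi n p =
     Min ((\<lambda>\<alpha>. Max (Poly_Mapping.lookup \<alpha> ` {1..n})) ` top_exponents n p) + 1"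

text \<open>
  Parallel edges have to be distinguishable, since each copy carries its own coefficients. So
  \<open>E\<close> is a finite set of edge names, and \<open>V e\<close> is the set of vertices of the edge named \<open>e\<close>;
  \<open>V\<close> need not be injective. Cardinalities of sets of edge names thus count with multiplicity.
\<close>

definition hypergraph :: "nat \<Rightarrow> 'e set \<Rightarrow> ('e \<Rightarrow> nat set) \<Rightarrow> bool" where
  "hypergraph n E V \<longleftrightarrow> finite E \<and> (\<forall>e\<in>E. V e \<subseteq> {1..n} \<and> card (V e) \<ge> 2)"

definition induced_edges :: "'e set \<Rightarrow> ('e \<Rightarrow> nat set) \<Rightarrow> nat set \<Rightarrow> 'e set" where
  "induced_edges E V X = {e \<in> E. V e \<subseteq> X}"

definition induced_degree :: "'e set \<Rightarrow> ('e \<Rightarrow> nat set) \<Rightarrow> nat set \<Rightarrow> nat \<Rightarrow> nat" where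
  "induced_degree E V X i = card {e \<in> E. i \<in> V e \<and> V e \<subseteq> X}"

definition degeneracy :: "nat \<Rightarrow> 'e set \<Rightarrow> ('e \<Rightarrow> nat set) \<Rightarrow> nat" where
  "degeneracy n E V =
     Max ((\<lambda>X. Min (induced_degree E V X ` X)) ` {X. X \<noteq> {} \<and> X \<subseteq> {1..n}})"

definition edge_density :: "nat \<Rightarrow> 'e set \<Rightarrow> ('e \<Rightarrow> nat set) \<Rightarrow> real" where
  "edge_density n E V =
     Max ((\<lambda>X. real (card (induced_edges E V X)) / real (card X)) ` {X. X \<noteq> {} \<and> X \<subseteq> {1..n}})"

text \<open>
  For \<open>E = {}\<close> this is an unspecified number; it then only occurs multiplied by the edge
  density, which is \<open>0\<close>, so no convention is needed.
\<close>

definition max_edge_size :: "'e set \<Rightarrow> ('e \<Rightarrow> nat set) \<Rightarrow> nat" where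
  "max_edge_size E V = Max ((\<lambda>e. card (V e)) ` E)"

end

theory Submission
  imports Defs
begin

text \<open>
  Expanding \<open>p\<close>, every monomial comes from choosing a vertex in each edge, and its exponent at
  \<open>i\<close> counts the edges that chose \<open>i\<close>. Edges inside \<open>X\<close> choose vertices of \<open>X\<close>, so some
  exponent in \<open>X\<close> is at least \<open>|E(X)| / |X|\<close>; this gives \<open>ed(H) \<le> AT(p) - 1\<close>. Conversely,
  remove vertices of minimum degree one after the other and let each edge choose its first
  removed vertex. No other choice produces the same monomial, so there is no cancellation, and
  its exponents are at most \<open>\<delta>(H)\<close>. The middle inequality averages the degrees in \<open>H[X]\<close>.
\<close>

section \<open>Monomials in products of linear forms\<close>

lemma mconst_mult_mvar:
  "mconst c * mvar i = Poly_Mapping.single (Poly_Mapping.single i 1) (c::'a::comm_semiring_1)"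
  by (simp add: mconst_def mvar_def mult_single)

text \<open>Exponent vectors can be cancelled, so \<gamma> is the only exponent of \<open>P\<close>
  that multiplication by a monomial with exponent \<open>k\<close> moves to
  \<open>\<gamma> + k\<close>.\<close>

lemma lookup_mult_single_add:
  fixes P :: "'b::cancel_comm_monoid_add \<Rightarrow>\<^sub>0 'a::comm_semiring_1"
  shows "Poly_Mapping.lookup (P * Poly_Mapping.single k c) (\<gamma> + k) = Poly_Mapping.lookup P \<gamma> * c"
proof -
  have "(\<Sum>q. Poly_Mapping.lookup (Poly_Mapping.single k c) q when \<gamma> + k = l + q)
        = (c when l = \<gamma>)" for l
  proof -
    have "(\<lambda>q. Poly_Mapping.lookup (Poly_Mapping.single k c) q when \<gamma> + k = l + q)
          = (\<lambda>q. (c when l = \<gamma>) when q = k)"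
      by (auto simp: fun_eq_iff lookup_single when_def)
    then show ?thesis by (simp only: Sum_any_when_equal)
  qed
  then show ?thesis by (simp add: lookup_mult mult_when)
qed

lemma keys_linear_form:
  fixes c :: "nat \<Rightarrow> 'a::comm_semiring_1"
  assumes "\<alpha> \<in> Poly_Mapping.keys (\<Sum>i\<in>S. mconst (c i) * mvar i)"
  shows "\<exists>i\<in>S. \<alpha> = Poly_Mapping.single i 1"
proof -
  have "(\<Sum>i\<in>S. Poly_Mapping.lookup (mconst (c i) * mvar i) \<alpha>) \<noteq> 0"
    using assms by (simp add: in_keys_iff lookup_sum)
  then obtain i where "i \<in> S" "Poly_Mapping.lookup (mconst (c i) * mvar i) \<alpha> \<noteq> 0"
    by (rule sum.not_neutral_contains_not_neutral)
  then show ?thesis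
    by (auto simp: mconst_mult_mvar lookup_single when_def split: if_splits)
qed

text \<open>Each factor contributes one variable, so a choice \<open>f\<close> is built edge by
  edge. The converse can fail: different choices may yield the same monomial with coefficients that
  cancel.\<close>

lemma keys_prod_linear_forms:
  fixes a :: "'e \<Rightarrow> nat \<Rightarrow> 'a::comm_semiring_1"
  assumes "finite F" and "\<alpha> \<in> Poly_Mapping.keys (\<Prod>e\<in>F. \<Sum>i\<in>V e. mconst (a e i) * mvar i)"
  shows "\<exists>f. (\<forall>e\<in>F. f e \<in> V e) \<and> (\<forall>i. Poly_Mapping.lookup \<alpha> i = card {e \<in> F. f e = i})"
  using assms
proof (induction F arbitrary: \<alpha> rule: finite_induct)
  case empty
  then show ?case by simp
next
  case (insert e F)
  let ?L = "\<lambda>e. \<Sum>i\<in>V e. mconst (a e i) * mvar i"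
  have "\<alpha> \<in> Poly_Mapping.keys (?L e * prod ?L F)"
    using insert by simp
  then obtain \<mu> \<beta> where \<alpha>: "\<alpha> = \<mu> + \<beta>"
    and l: "\<mu> \<in> Poly_Mapping.keys (?L e)" and b: "\<beta> \<in> Poly_Mapping.keys (prod ?L F)"
    using keys_mult by blast
  obtain v where v: "v \<in> V e" "\<mu> = Poly_Mapping.single v 1"
    using keys_linear_form[OF l] by blast
  obtain f where f: "\<forall>e\<in>F. f e \<in> V e" "\<forall>i. Poly_Mapping.lookup \<beta> i = card {e \<in> F. f e = i}"
    using insert.IH[OF b] by blast
  let ?f = "f(e := v)"
  have "Poly_Mapping.lookup \<alpha> i = card {x \<in> insert e F. ?f x = i}" for i
  proof -
    \<comment> \<open>Redefining \<open>f\<close> at \<open>e\<close> leaves the counts over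
      \<open>F\<close> unchanged, because \<open>e\<close> is not in \<open>F\<close>.\<close>
    have "{x \<in> insert e F. ?f x = i} = (if v = i then insert e {x \<in> F. f x = i} else {x \<in> F. f x = i})"
      using insert.hyps by auto
    then show ?thesis
      using insert.hyps f(2) by (simp add: \<alpha> v(2) lookup_add lookup_single)
  qed
  moreover have "\<forall>x\<in>insert e F. ?f x \<in> V x"
    using f(1) v(1) by auto
  ultimately show ?case by blast
qed

lemma sum_card_fibers:
  assumes "finite F" "finite X"
  shows "(\<Sum>i\<in>X. card {e \<in> F. f e = i}) = card {e \<in> F. f e \<in> X}"
proof -
  have "(\<Sum>i\<in>X. card {e \<in> F. f e = i}) = (\<Sum>i\<in>X. card {e \<in> {e \<in> F. f e \<in> X}. f e = i})"
    by (auto intro!: sum.cong arg_cong[of _ _ card])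
  also have "\<dots> = card {e \<in> F. f e \<in> X}"
    using sum_fun_comp[of "{e \<in> F. f e \<in> X}" X f "\<lambda>_. 1::nat"] assms
    by (simp add: image_subset_iff)
  finally show ?thesis .
qed

text \<open>The bound \<open>k\<close> on the \<open>v\<close>-degree of \<open>P\<close> excludes contributions of the other variables of
  the linear form.\<close>

lemma lookup_mult_linear_form_top:
  fixes P :: "'a::comm_semiring_1 mpoly"
  assumes "\<And>\<beta>. \<beta> \<in> Poly_Mapping.keys P \<Longrightarrow> Poly_Mapping.lookup \<beta> v \<le> k"
    and "Poly_Mapping.lookup \<gamma> v = k" and "finite S" "v \<in> S"
  shows "Poly_Mapping.lookup (P * (\<Sum>i\<in>S. mconst (c i) * mvar i)) (\<gamma> + Poly_Mapping.single v 1)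
         = Poly_Mapping.lookup P \<gamma> * c v"
proof -
  let ?\<gamma> = "\<gamma> + Poly_Mapping.single v 1"
  \<comment> \<open>To reach \<open>?\<gamma>\<close> by a variable other than \<open>v\<close>, a
    monomial of \<open>P\<close> would already need exponent \<open>k + 1\<close> at
    \<open>v\<close>.\<close>
  have zero: "Poly_Mapping.lookup (P * (mconst (c i) * mvar i)) ?\<gamma> = 0" if "i \<noteq> v" for i
  proof (rule ccontr)
    assume "\<not> ?thesis"
    then have "?\<gamma> \<in> Poly_Mapping.keys (P * Poly_Mapping.single (Poly_Mapping.single i 1) (c i))"
      by (simp add: in_keys_iff mconst_mult_mvar)
    then obtain \<beta> where \<beta>: "\<beta> \<in> Poly_Mapping.keys P" "?\<gamma> = \<beta> + Poly_Mapping.single i 1"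
      using keys_mult[of P] by (fastforce split: if_splits)
    from \<beta>(2) have "Poly_Mapping.lookup ?\<gamma> v = Poly_Mapping.lookup (\<beta> + Poly_Mapping.single i 1) v"
      by simp
    then have "Poly_Mapping.lookup \<beta> v = k + 1"
      using that assms(2) by (simp add: lookup_add lookup_single)
    with assms(1)[OF \<beta>(1)] show False by simp
  qed
  have "Poly_Mapping.lookup (P * (\<Sum>i\<in>S. mconst (c i) * mvar i)) ?\<gamma>
        = (\<Sum>i\<in>S. Poly_Mapping.lookup (P * (mconst (c i) * mvar i)) ?\<gamma>)"
    by (simp add: sum_distrib_left lookup_sum)
  also have "\<dots> = (\<Sum>i\<in>{v}. Poly_Mapping.lookup (P * (mconst (c i) * mvar i)) ?\<gamma>)"
    using assms(3,4) zero by (intro sum.mono_neutral_right) auto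
  also have "\<dots> = Poly_Mapping.lookup P \<gamma> * c v"
    using lookup_mult_single_add[of P "Poly_Mapping.single v 1" "c v" \<gamma>]
    by (simp add: mconst_mult_mvar)
  finally show ?thesis .
qed

section \<open>Coefficients without cancellation\<close>

text \<open>As \<open>P\<close> is free of \<open>v\<close>, the exponent of \<open>v\<close>
  reaches \<open>card D\<close> only if every one of the \<open>card D\<close> factors contributes
  \<open>v\<close>. Hence a single choice produces this coefficient.\<close>

lemma lookup_mult_prod_linear_forms_top:
  fixes P :: "'a::comm_semiring_1 mpoly"
  assumes P: "\<And>\<beta>. \<beta> \<in> Poly_Mapping.keys P \<Longrightarrow> Poly_Mapping.lookup \<beta> v = 0"
    and \<gamma>: "Poly_Mapping.lookup \<gamma> v = 0"
    and "finite D" and "\<And>e. e \<in> D \<Longrightarrow> finite (V e) \<and> v \<in> V e"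
  shows "Poly_Mapping.lookup (P * (\<Prod>e\<in>D. \<Sum>i\<in>V e. mconst (a e i) * mvar i))
           (\<gamma> + Poly_Mapping.single v (card D))
         = Poly_Mapping.lookup P \<gamma> * (\<Prod>e\<in>D. a e v)"
  using assms(3,4)
proof (induction D rule: finite_induct)
  case empty
  then show ?case by simp
next
  case (insert e D)
  let ?L = "\<lambda>e. \<Sum>i\<in>V e. mconst (a e i) * mvar i"
  let ?\<gamma> = "\<gamma> + Poly_Mapping.single v (card D)"
  \<comment> \<open>The exponent of \<open>v\<close> comes from the factors in \<open>D\<close>
    alone, and each adds at most one; so \<open>k = card D\<close> is admissible for the next
    factor.\<close>
  have bound: "Poly_Mapping.lookup \<beta> v \<le> card D"
    if \<beta>: "\<beta> \<in> Poly_Mapping.keys (P * prod ?L D)" for \<beta>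
  proof -
    obtain \<beta>1 \<beta>2 where \<beta>12: "\<beta> = \<beta>1 + \<beta>2" "\<beta>1 \<in> Poly_Mapping.keys P"
      and \<beta>2: "\<beta>2 \<in> Poly_Mapping.keys (prod ?L D)"
      using \<beta> keys_mult by blast
    obtain f where f: "\<forall>i. Poly_Mapping.lookup \<beta>2 i = card {e \<in> D. f e = i}"
      using keys_prod_linear_forms[OF insert.hyps(1) \<beta>2] by blast
    have "card {e \<in> D. f e = v} \<le> card D"
      using insert.hyps(1) by (intro card_mono) auto
    then show ?thesis using f \<beta>12 P by (simp add: lookup_add)
  qed
  have "Poly_Mapping.lookup ((P * prod ?L D) * ?L e) (?\<gamma> + Poly_Mapping.single v 1)
        = Poly_Mapping.lookup (P * prod ?L D) ?\<gamma> * a e v"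
    using insert.prems bound \<gamma>
    by (intro lookup_mult_linear_form_top[where k = "card D"]) (auto simp: lookup_add)
  also have "(P * prod ?L D) * ?L e = P * prod ?L (insert e D)"
    using insert.hyps by (simp add: algebra_simps)
  also have "?\<gamma> + Poly_Mapping.single v 1 = \<gamma> + Poly_Mapping.single v (card (insert e D))"
    using insert.hyps by (simp add: add.assoc flip: single_add)
  also have "Poly_Mapping.lookup (P * prod ?L D) ?\<gamma> * a e v
             = Poly_Mapping.lookup P \<gamma> * (\<Prod>e\<in>insert e D. a e v)"
    using insert by (simp add: algebra_simps)
  finally show ?case .
qed

text \<open>A vertex \<open>v\<close> of degree at most \<open>d\<close> in the hypergraph induced
  on \<open>X\<close> is removed, and all edges lost with it choose \<open>v\<close>. The hypothesis
  concerns every nonempty subset of \<open>X\<close>, so it passes to \<open>X - {v}\<close> and the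
  induction continues.\<close>

lemma exists_bounded_key_if_degenerate:
  fixes a :: "'e \<Rightarrow> nat \<Rightarrow> 'a::idom"
  assumes "finite E" and V: "\<And>e. e \<in> E \<Longrightarrow> finite (V e) \<and> V e \<noteq> {}"
    and a: "\<And>e i. e \<in> E \<Longrightarrow> i \<in> V e \<Longrightarrow> a e i \<noteq> 0"
    and "finite X"
    and "\<And>Y. Y \<noteq> {} \<Longrightarrow> Y \<subseteq> X \<Longrightarrow> \<exists>v\<in>Y. induced_degree E V Y v \<le> d"
  shows "\<exists>\<alpha> \<in> Poly_Mapping.keys (\<Prod>e\<in>induced_edges E V X. \<Sum>i\<in>V e. mconst (a e i) * mvar i).
           \<forall>i. Poly_Mapping.lookup \<alpha> i \<le> d"
  using assms(4,5)
proof (induction X rule: finite_psubset_induct)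
  case (psubset X)
  let ?L = "\<lambda>e. \<Sum>i\<in>V e. mconst (a e i) * mvar i"
  show ?case
  proof (cases "X = {}")
    case True
    \<comment> \<open>Edges are nonempty, so none lies in the empty set; the empty product is 1,
      with zero exponents only.\<close>
    then have "induced_edges E V X = {}"
      using V by (auto simp: induced_edges_def)
    then show ?thesis by simp
  next
    case False
    then obtain v where v: "v \<in> X" "induced_degree E V X v \<le> d"
      using psubset.prems by blast
    let ?F = "induced_edges E V (X - {v})" and ?D = "{e \<in> E. v \<in> V e \<and> V e \<subseteq> X}"
    have fin: "finite ?F" "finite ?D"
      using assms(1) by (auto simp: induced_edges_def)
    obtain \<gamma> where \<gamma>: "\<gamma> \<in> Poly_Mapping.keys (prod ?L ?F)" "\<And>i. Poly_Mapping.lookup \<gamma> i \<le> d"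
    proof -
      have "\<exists>\<alpha> \<in> Poly_Mapping.keys (prod ?L ?F). \<forall>i. Poly_Mapping.lookup \<alpha> i \<le> d"
        using v(1) psubset.prems by (intro psubset.IH) auto
      then show ?thesis using that by blast
    qed
    \<comment> \<open>The edges of \<open>?F\<close> avoid \<open>v\<close>, so no choice from them
      can pick it.\<close>
    have zero: "Poly_Mapping.lookup \<beta> v = 0" if \<beta>: "\<beta> \<in> Poly_Mapping.keys (prod ?L ?F)" for \<beta>
    proof -
      obtain f where f: "\<forall>e\<in>?F. f e \<in> V e"
        "\<forall>i. Poly_Mapping.lookup \<beta> i = card {e \<in> ?F. f e = i}"
        using keys_prod_linear_forms[OF fin(1) \<beta>] by blast
      have no_v: "{e \<in> ?F. f e = v} = {}"
        using f(1) by (auto simp: induced_edges_def)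
      show ?thesis unfolding f(2)[rule_format] no_v by simp
    qed
    let ?\<alpha> = "\<gamma> + Poly_Mapping.single v (card ?D)"
    have "Poly_Mapping.lookup (prod ?L ?F * prod ?L ?D) ?\<alpha>
          = Poly_Mapping.lookup (prod ?L ?F) \<gamma> * (\<Prod>e\<in>?D. a e v)"
      using zero \<gamma>(1) fin(2) V by (intro lookup_mult_prod_linear_forms_top) auto
    \<comment> \<open>Without zero divisors, the nonzero coefficient at \<gamma> and the nonzero
      \<open>a e v\<close> have a nonzero product.\<close>
    also have "\<dots> \<noteq> 0"
      using \<gamma>(1) a fin(2) by (auto simp: in_keys_iff)
    finally have "?\<alpha> \<in> Poly_Mapping.keys (prod ?L ?F * prod ?L ?D)"
      by (simp add: in_keys_iff)
    also have "prod ?L ?F * prod ?L ?D = prod ?L (?F \<union> ?D)"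
      using fin by (intro prod.union_disjoint[symmetric]) (auto simp: induced_edges_def)
    also have "?F \<union> ?D = induced_edges E V X"
      by (auto simp: induced_edges_def)
    finally have "?\<alpha> \<in> Poly_Mapping.keys (prod ?L (induced_edges E V X))" .
    \<comment> \<open>At \<open>v\<close> the exponent is exactly \<open>card ?D\<close>, the
      induced degree of \<open>v\<close>; elsewhere it is that of \<gamma>.\<close>
    moreover have "Poly_Mapping.lookup ?\<alpha> i \<le> d" for i
      using \<gamma> v(2) zero[OF \<gamma>(1)]
      by (auto simp: lookup_add lookup_single induced_degree_def when_def)
    ultimately show ?thesis by blast
  qed
qed

section \<open>Degeneracy and edge density\<close>

text \<open>Double counting of incidences: an edge inside \<open>X\<close> has all its vertices in
  \<open>X\<close>, so it is counted \<open>card (V e)\<close> times.\<close>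

lemma sum_induced_degree:
  assumes "finite E" "finite X"
  shows "(\<Sum>i\<in>X. induced_degree E V X i) = (\<Sum>e\<in>induced_edges E V X. card (V e))"
proof -
  have "(\<Sum>i\<in>X. induced_degree E V X i) = (\<Sum>i\<in>X. card {e \<in> induced_edges E V X. i \<in> V e})"
    by (auto simp: induced_degree_def induced_edges_def intro!: sum.cong arg_cong[of _ _ card])
  also have "\<dots> = (\<Sum>e\<in>induced_edges E V X. card {i \<in> X. i \<in> V e})"
    using assms by (intro sum_multicount_gen) (auto simp: induced_edges_def)
  also have "\<dots> = (\<Sum>e\<in>induced_edges E V X. card (V e))"
    by (auto simp: induced_edges_def intro!: sum.cong arg_cong[of _ _ card])
  finally show ?thesis .
qed

text \<open>This supplies the hypothesis of \<open>exists_bounded_key_if_degenerate\<close> with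
  \<open>d\<close> the degeneracy.\<close>

lemma degeneracy_witness:
  assumes "Y \<noteq> {}" "Y \<subseteq> {1..n}"
  shows "\<exists>v\<in>Y. induced_degree E V Y v \<le> degeneracy n E V"
proof -
  have fin: "finite Y" using assms finite_subset by blast
  have "Min (induced_degree E V Y ` Y) \<in> induced_degree E V Y ` Y"
    using assms fin by (intro Min_in) auto
  moreover have "Min (induced_degree E V Y ` Y) \<le> degeneracy n E V"
    unfolding degeneracy_def using assms by (intro Max_ge) auto
  ultimately show ?thesis by auto
qed

lemma degeneracy_attained:
  assumes "n \<ge> 1"
  shows "\<exists>X. X \<noteq> {} \<and> X \<subseteq> {1..n} \<and> (\<forall>i\<in>X. degeneracy n E V \<le> induced_degree E V X i)"
proof -
  let ?m = "\<lambda>X. Min (induced_degree E V X ` X)" and ?S = "{X. X \<noteq> {} \<and> X \<subseteq> {1..n}}"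
  have "{1..n} \<in> ?S"
    using assms by simp
  then have "?m ` ?S \<noteq> {}" by blast
  then have "degeneracy n E V \<in> ?m ` ?S"
    unfolding degeneracy_def by (intro Max_in) simp_all
  then obtain X where X: "X \<noteq> {}" "X \<subseteq> {1..n}" "degeneracy n E V = ?m X" by auto
  moreover have "finite X" using X(2) finite_subset by blast
  ultimately show ?thesis by auto
qed

lemma edge_density_ge:
  assumes "X \<noteq> {}" "X \<subseteq> {1..n}"
  shows "real (card (induced_edges E V X)) / real (card X) \<le> edge_density n E V"
  unfolding edge_density_def using assms by (intro Max_ge) auto

lemma edge_density_le:
  assumes "n \<ge> 1"
    and "\<And>X. X \<noteq> {} \<Longrightarrow> X \<subseteq> {1..n} \<Longrightarrow> real (card (induced_edges E V X)) \<le> b * real (card X)"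
  shows "edge_density n E V \<le> b"
  unfolding edge_density_def
proof (rule Max.boundedI)
  have "{1..n} \<in> {X. X \<noteq> {} \<and> X \<subseteq> {1..n}}"
    using assms(1) by simp
  then show "(\<lambda>X. real (card (induced_edges E V X)) / real (card X)) ` {X. X \<noteq> {} \<and> X \<subseteq> {1..n}} \<noteq> {}"
    by blast
next
  fix y
  assume "y \<in> (\<lambda>X. real (card (induced_edges E V X)) / real (card X)) ` {X. X \<noteq> {} \<and> X \<subseteq> {1..n}}"
  then obtain X where X: "X \<noteq> {}" "X \<subseteq> {1..n}"
    "y = real (card (induced_edges E V X)) / real (card X)" by auto
  have "finite X" using X(2) finite_subset by blast
  then have "card X > 0" using X(1) by (simp add: card_gt_0_iff)
  then show "y \<le> b" using X assms(2)[OF X(1,2)] by (simp add: divide_le_eq)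
qed simp

text \<open>On a set \<open>X\<close> attaining the degeneracy, every induced degree is at least the
  degeneracy, while the degree sum is at most the maximal edge size times the number of edges in
  \<open>X\<close>.\<close>

lemma degeneracy_le_edge_density:
  assumes "n \<ge> 1" "finite E"
  shows "real (degeneracy n E V) \<le> real (max_edge_size E V) * edge_density n E V"
proof -
  let ?r = "max_edge_size E V"
  obtain X where X: "X \<noteq> {}" "X \<subseteq> {1..n}"
    and deg: "\<And>i. i \<in> X \<Longrightarrow> degeneracy n E V \<le> induced_degree E V X i"
    using degeneracy_attained[OF assms(1)] by meson
  have fin: "finite X" using X(2) finite_subset by blast
  have "card X * degeneracy n E V \<le> (\<Sum>i\<in>X. induced_degree E V X i)"
    using deg sum_bounded_below[of X "degeneracy n E V"] by simp
  also have "\<dots> = (\<Sum>e\<in>induced_edges E V X. card (V e))"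
    using assms(2) fin by (rule sum_induced_degree)
  also have "\<dots> \<le> card (induced_edges E V X) * ?r"
  proof -
    \<comment> \<open>For empty \<open>E\<close> this is vacuous, so the unspecified value of
      \<open>?r\<close> does no harm.\<close>
    have "card (V e) \<le> ?r" if "e \<in> induced_edges E V X" for e
      unfolding max_edge_size_def using that assms(2)
      by (intro Max_ge) (auto simp: induced_edges_def)
    then show ?thesis using sum_bounded_above[of "induced_edges E V X" _ ?r] by simp
  qed
  finally have "real (card X) * real (degeneracy n E V) \<le> real (card (induced_edges E V X)) * real ?r"
    by (metis of_nat_le_iff of_nat_mult)
  moreover have "card X > 0" using X fin by (simp add: card_gt_0_iff)
  ultimately have "real (degeneracy n E V) \<le> real ?r * (real (card (induced_edges E V X)) / real (card X))"
    by (simp add: field_simps)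
  also have "\<dots> \<le> real ?r * edge_density n E V"
    using edge_density_ge[OF X] by (intro mult_left_mono) auto
  finally show ?thesis .
qed

section \<open>Homogeneity and the chain of inequalities\<close>

lemma top_exponents_homogeneous:
  assumes "p \<noteq> 0" and "\<And>\<alpha>. \<alpha> \<in> Poly_Mapping.keys p \<Longrightarrow> mon_degree n \<alpha> = d"
  shows "top_exponents n p = Poly_Mapping.keys p"
proof -
  obtain \<alpha> where "\<alpha> \<in> Poly_Mapping.keys p"
    using assms(1) keys_eq_empty by fastforce
  then have "mon_degree n ` Poly_Mapping.keys p = {d}"
    using assms(2) by (auto intro: rev_image_eqI)
  then have "total_degree n p = d"
    by (simp add: total_degree_def)
  with assms(2) show ?thesis
    by (auto simp: top_exponents_def simp flip: in_keys_iff)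
qed

theorem theorem2p4:
  fixes n :: nat
    and E :: "'e set"
    and V :: "'e \<Rightarrow> nat set"
    and a :: "'e \<Rightarrow> nat \<Rightarrow> 'a::field"
    and p :: "'a mpoly"
  assumes "n \<ge> 1"
    and "hypergraph n E V"
    and "\<forall>e\<in>E. \<forall>i\<in>V e. a e i \<noteq> 0"
    and "p = (\<Prod>e\<in>E. \<Sum>i\<in>V e. mconst (a e i) * mvar i)"
  shows "real (alon_tarsi n p) - 1 \<le> real (degeneracy n E V) \<and>
         real (degeneracy n E V) \<le> real (max_edge_size E V) * edge_density n E V \<and>
         real (max_edge_size E V) * edge_density n E V
           \<le> real (max_edge_size E V) * (real (alon_tarsi n p) - 1)"
proof -
  have fin: "finite E" and sub: "\<And>e. e \<in> E \<Longrightarrow> V e \<subseteq> {1..n}"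
    and card2: "\<And>e. e \<in> E \<Longrightarrow> card (V e) \<ge> 2"
    using assms(2) by (auto simp: hypergraph_def)
  \<comment> \<open>Infinite sets have cardinality 0, so a cardinality of at least 2 also gives
    finiteness.\<close>
  have V: "finite (V e) \<and> V e \<noteq> {}" if "e \<in> E" for e
    using card2[OF that] by (metis card.empty card.infinite not_numeral_le_zero)
  let ?S = "top_exponents n p" and ?M = "\<lambda>\<alpha>. Max (Poly_Mapping.lookup \<alpha> ` {1..n})"
  have choice: "\<exists>f. (\<forall>e\<in>E. f e \<in> V e) \<and> (\<forall>i. Poly_Mapping.lookup \<alpha> i = card {e \<in> E. f e = i})"
    if "\<alpha> \<in> Poly_Mapping.keys p" for \<alpha>
    using keys_prod_linear_forms[OF fin] that assms(4) by simp
  have "induced_edges E V {1..n} = E"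
    using sub by (auto simp: induced_edges_def)
  moreover have "\<exists>\<alpha> \<in> Poly_Mapping.keys
      (\<Prod>e\<in>induced_edges E V {1..n}. \<Sum>i\<in>V e. mconst (a e i) * mvar i).
        \<forall>i. Poly_Mapping.lookup \<alpha> i \<le> degeneracy n E V"
    by (rule exists_bounded_key_if_degenerate[OF fin V _ _ degeneracy_witness])
      (use assms(3) in auto)
  ultimately obtain \<alpha>0 where \<alpha>0: "\<alpha>0 \<in> Poly_Mapping.keys p"
    and \<alpha>0_le: "\<And>i. Poly_Mapping.lookup \<alpha>0 i \<le> degeneracy n E V"
    using assms(4) by auto
  \<comment> \<open>Each edge makes one choice, so \<open>p\<close> is homogeneous of degree
    \<open>card E\<close> and the top exponents are all its exponents.\<close>
  have "mon_degree n \<alpha> = card E" if \<alpha>: "\<alpha> \<in> Poly_Mapping.keys p" for \<alpha>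
  proof -
    obtain f where f: "\<forall>e\<in>E. f e \<in> V e" "\<forall>i. Poly_Mapping.lookup \<alpha> i = card {e \<in> E. f e = i}"
      using choice[OF \<alpha>] by blast
    have "{e \<in> E. f e \<in> {1..n}} = E" using f(1) sub by blast
    then show ?thesis
      using sum_card_fibers[OF fin, of "{1..n}" f] f(2) by (simp add: mon_degree_def)
  qed
  moreover have "p \<noteq> 0" using \<alpha>0 by auto
  ultimately have S: "?S = Poly_Mapping.keys p" by (rule top_exponents_homogeneous[rotated])
  then have S_fin: "finite ?S" and S_ne: "?S \<noteq> {}" using \<alpha>0 by auto
  \<comment> \<open>The monomial found by vertex removal competes in the minimum that defines the
    Alon-Tarsi number.\<close>
  have "Min (?M ` ?S) \<le> ?M \<alpha>0"
    using S S_fin \<alpha>0 by (intro Min_le) auto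
  also have "\<dots> \<le> degeneracy n E V"
    using assms(1) \<alpha>0_le by (intro Max.boundedI) auto
  finally have first: "real (alon_tarsi n p) - 1 \<le> real (degeneracy n E V)"
    by (simp add: alon_tarsi_def)
  have "Min (?M ` ?S) \<in> ?M ` ?S"
    using S_fin S_ne by (intro Min_in) auto
  \<comment> \<open>A monomial attaining the minimum; the \<open>+ 1\<close> in
    \<open>alon_tarsi\<close> makes the real subtraction exact.\<close>
  then obtain \<alpha> where \<alpha>: "\<alpha> \<in> Poly_Mapping.keys p" and AT: "real (alon_tarsi n p) - 1 = real (?M \<alpha>)"
    using S by (auto simp: alon_tarsi_def)
  obtain f where f: "\<forall>e\<in>E. f e \<in> V e" "\<forall>i. Poly_Mapping.lookup \<alpha> i = card {e \<in> E. f e = i}"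
    using choice[OF \<alpha>] by blast
  have "edge_density n E V \<le> real (?M \<alpha>)"
  proof (rule edge_density_le[OF assms(1)])
    fix X assume X: "X \<noteq> {}" "X \<subseteq> {1..n}"
    then have finX: "finite X" using finite_subset by blast
    \<comment> \<open>Edges inside \<open>X\<close> must choose in \<open>X\<close>; edges that
      merely meet \<open>X\<close> may do so too, hence only an inequality.\<close>
    have "card (induced_edges E V X) \<le> card {e \<in> E. f e \<in> X}"
      using f(1) fin by (intro card_mono) (auto simp: induced_edges_def)
    also have "\<dots> = (\<Sum>i\<in>X. Poly_Mapping.lookup \<alpha> i)"
      using sum_card_fibers[OF fin finX, of f] f(2) by simp
    also have "\<dots> \<le> card X * ?M \<alpha>"
    proof -
      have "Poly_Mapping.lookup \<alpha> i \<le> ?M \<alpha>" if "i \<in> X" for i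
        using that X(2) by (intro Max_ge) auto
      then show ?thesis using sum_bounded_above[of X _ "?M \<alpha>"] by simp
    qed
    finally show "real (card (induced_edges E V X)) \<le> real (?M \<alpha>) * real (card X)"
      by (metis mult.commute of_nat_le_iff of_nat_mult)
  qed
  then have "real (max_edge_size E V) * edge_density n E V
             \<le> real (max_edge_size E V) * (real (alon_tarsi n p) - 1)"
    unfolding AT by (intro mult_left_mono) auto
  with first degeneracy_le_edge_density[OF assms(1) fin] show ?thesis by blast
qed

end
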